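(* Let $\mathcal{C}\subset\mathcal{P}(\mathcal{B}(\mathcal{K}),\mathcal{B}(\mathcal{H}))$ be an arbitrary mcs-cone. Then its dual cone $\mathcal{C}^{\circ}$ is an mcs-cone as well.
   Context: $\mathcal{K},\mathcal{H}$ are complex Hilbert spaces of finite dimensions $m,n\geq 1$, and $\mathcal{B}(\mathcal{K}),\mathcal{B}(\mathcal{H})$ are the spaces of linear operators on them, each with the inner product $\langle A,B\rangle'=\operatorname{Tr}(AB^{*})$. Let $\{f_j\}_{j=1}^m$ be a fixed orthonormal basis of $\mathcal{K}$ and let $f_{kl}\in\mathcal{B}(\mathcal{K})$ be the matrix units, $f_{kl}(f_j)=\delta_{lj}f_k$. On linear maps $\mathcal{B}(\mathcal{K})\to\mathcal{B}(\mathcal{H})$ one uses the inner product $\langle\Phi,\Psi\rangle''=\sum_{k,l=1}^m\langle\Phi(f_{kl}),\Psi(f_{kl})\rangle'$. $\mathcal{P}(\mathcal{B}(\mathcal{K}),\mathcal{B}(\mathcal{H}))$ is the set of positive linear maps $\mathcal{B}(\mathcal{K})\to\mathcal{B}(\mathcal{H})$ (sending positive semidefinite operators to positive semidefinite operators). $\mathcal{CP}(\mathcal{B}(\mathcal{K}))$ and $\mathcal{CP}(\mathcal{B}(\mathcal{H}))$ are the sets of completely positive maps of $\mathcal{B}(\mathcal{K})$, respectively $\mathcal{B}(\mathcal{H})$, into itself. $\mathcal{HP}(\mathcal{B}(\mathcal{K}),\mathcal{B}(\mathcal{H}))$ is the real vector space of Hermiticity-preserving linear maps, i.e. $\Phi(X^{*})=\Phi(X)^{*}$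 for all $X$; on it $\langle\cdot,\cdot\rangle''$ is a real symmetric inner product. A cone with a mapping cone symmetry (mcs-cone) is a closed convex cone $\mathcal{C}\subset\mathcal{P}(\mathcal{B}(\mathcal{K}),\mathcal{B}(\mathcal{H}))$, $\mathcal{C}\neq\{0\}$, such that $\Upsilon\circ\Phi\circ\Omega\in\mathcal{C}$ for all $\Phi\in\mathcal{C}$, $\Upsilon\in\mathcal{CP}(\mathcal{B}(\mathcal{H}))$, $\Omega\in\mathcal{CP}(\mathcal{B}(\mathcal{K}))$. The dual of a cone $\mathcal{C}\subset\mathcal{HP}(\mathcal{B}(\mathcal{K}),\mathcal{B}(\mathcal{H}))$ is $\mathcal{C}^{\circ}=\{\Psi\in\mathcal{HP}(\mathcal{B}(\mathcal{K}),\mathcal{B}(\mathcal{H})):\langle\Psi,\Phi\rangle''\geq 0\ \text{for all }\Phi\in\mathcal{C}\}$. *)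

theory Defs
  imports "HOL-Analysis.Analysis"
begin

text \<open>
  A complex Hilbert space of finite dimension \<open>m \<ge> 1\<close> is modelled by \<open>complex ^ 'k\<close> with
  \<open>CARD('k) = m\<close> and the inner product \<open>cinner\<close>; operators on it are square matrices acting by
  \<open>*v\<close>. Inner products are linear in the first argument, in accordance with \<open>Tr (A B\<^sup>*)\<close>.
\<close>

type_synonym 'k operator = "complex ^ 'k ^ 'k"

definition cinner :: "complex ^ 'k::finite \<Rightarrow> complex ^ 'k \<Rightarrow> complex" where
  "cinner x y = (\<Sum>i\<in>UNIV. x $ i * cnj (y $ i))"

definition adj :: "'k::finite operator \<Rightarrow> 'k operator" where
  "adj A = (\<chi> i j. cnj (A $ j $ i))"

definition psd :: "'k::finite operator \<Rightarrow> bool" where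
  "psd A \<longleftrightarrow> (\<forall>v. cinner (A *v v) v \<in> \<real>\<^sub>\<ge>\<^sub>0)"

definition hs_inner :: "'k::finite operator \<Rightarrow> 'k operator \<Rightarrow> complex" where
  "hs_inner A B = trace (A ** adj B)"

text \<open>
  The index type is that of the coordinates, so an orthonormal family has \<open>CARD('k)\<close> members and
  is automatically a basis.
\<close>

definition orthonormal_basis :: "('k::finite \<Rightarrow> complex ^ 'k) \<Rightarrow> bool" where
  "orthonormal_basis f \<longleftrightarrow> (\<forall>i j. cinner (f i) (f j) = (if i = j then 1 else 0))"

definition matrix_unit :: "('k::finite \<Rightarrow> complex ^ 'k) \<Rightarrow> 'k \<Rightarrow> 'k \<Rightarrow> 'k operator" where
  "matrix_unit f k l = (\<chi> i j. f k $ i * cnj (f l $ j))"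

lemma matrix_unit_basis:
  fixes f :: "'k::finite \<Rightarrow> complex ^ 'k"
  assumes "orthonormal_basis f"
  shows "matrix_unit f k l *v f j = (if l = j then f k else 0)"
proof -
  have "(\<Sum>i\<in>UNIV. f k $ a * cnj (f l $ i) * f j $ i) = f k $ a * cinner (f j) (f l)" for a
    by (simp add: cinner_def sum_distrib_left mult_ac)
  then have "(\<Sum>i\<in>UNIV. f k $ a * cnj (f l $ i) * f j $ i) = (if l = j then f k $ a else 0)" for a
    using assms by (auto simp: orthonormal_basis_def)
  then show ?thesis
    by (simp add: vec_eq_iff matrix_unit_def matrix_vector_mult_def)
qed

text \<open>
  Maps between operator spaces live in the normed space of bounded real-linear maps, in which
  every linear map is bounded; complex linearity is imposed as homogeneity.
\<close>

type_synonym ('k, 'h) superop = "'k operator \<Rightarrow>\<^sub>L 'h operator"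

definition clinear_maps :: "('k::finite, 'h::finite) superop set" where
  "clinear_maps =
    {\<Phi>. \<forall>c X. blinfun_apply \<Phi> (map_matrix ((*) c) X) = map_matrix ((*) c) (blinfun_apply \<Phi> X)}"

definition positive_maps :: "('k::finite, 'h::finite) superop set" where
  "positive_maps = {\<Phi> \<in> clinear_maps. \<forall>X. psd X \<longrightarrow> psd (blinfun_apply \<Phi> X)}"

definition hp_maps :: "('k::finite, 'h::finite) superop set" where
  "hp_maps = {\<Phi> \<in> clinear_maps. \<forall>X. blinfun_apply \<Phi> (adj X) = adj (blinfun_apply \<Phi> X)}"

text \<open>
  Positivity of a \<open>d \<times> d\<close> block matrix of operators, as an operator on the \<open>d\<close>-fold direct sum of
  the underlying space. Only entries with indices below \<open>d\<close> matter.
\<close>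

definition block_psd :: "nat \<Rightarrow> (nat \<Rightarrow> nat \<Rightarrow> 'k::finite operator) \<Rightarrow> bool" where
  "block_psd d X \<longleftrightarrow>
    (\<forall>v :: nat \<Rightarrow> complex ^ 'k. (\<Sum>i<d. \<Sum>j<d. cinner (X i j *v v j) (v i)) \<in> \<real>\<^sub>\<ge>\<^sub>0)"

text \<open>Complete positivity: \<open>id \<otimes> \<Phi>\<close> is positive on \<open>d \<times> d\<close> block matrices for every \<open>d\<close>.\<close>

definition cp_maps :: "('k::finite, 'h::finite) superop set" where
  "cp_maps = {\<Phi> \<in> clinear_maps.
    \<forall>d X. block_psd d X \<longrightarrow> block_psd d (\<lambda>i j. blinfun_apply \<Phi> (X i j))}"

definition map_inner ::
    "('k::finite \<Rightarrow> complex ^ 'k) \<Rightarrow> ('k, 'h::finite) superop \<Rightarrow> ('k, 'h) superop \<Rightarrow> complex" where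
  "map_inner f \<Phi> \<Psi> = (\<Sum>k\<in>UNIV. \<Sum>l\<in>UNIV.
    hs_inner (blinfun_apply \<Phi> (matrix_unit f k l)) (blinfun_apply \<Psi> (matrix_unit f k l)))"

definition mcs_cone :: "('k::finite, 'h::finite) superop set \<Rightarrow> bool" where
  "mcs_cone C \<longleftrightarrow> C \<subseteq> positive_maps \<and> closed C \<and> convex_cone C \<and> C \<noteq> {0} \<and>
    (\<forall>\<Phi>\<in>C. \<forall>\<Upsilon>\<in>cp_maps. \<forall>\<Omega>\<in>cp_maps. \<Upsilon> o\<^sub>L \<Phi> o\<^sub>L \<Omega> \<in> C)"

text \<open>
  Meant for \<open>C \<subseteq> hp_maps\<close> and orthonormal \<open>f\<close>, where \<open>map_inner f\<close> takes real values, so that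
  membership in \<open>\<real>\<^sub>\<ge>\<^sub>0\<close> is just nonnegativity.
\<close>

definition dual_cone ::
    "('k::finite \<Rightarrow> complex ^ 'k) \<Rightarrow> ('k, 'h::finite) superop set \<Rightarrow> ('k, 'h) superop set" where
  "dual_cone f C = {\<Psi> \<in> hp_maps. \<forall>\<Phi>\<in>C. map_inner f \<Psi> \<Phi> \<in> \<real>\<^sub>\<ge>\<^sub>0}"

end

theory Submission
  imports Defs
begin

text \<open>
  The adjoint of a completely positive map for the Hilbert--Schmidt inner product is again completely
  positive, because the entrywise pairing of two positive semidefinite block matrices is nonnegative
  (Schur). Moving outer factors to the other side of the pairing, the dual cone inherits the symmetry
  of \<open>C\<close>. Pairing \<open>\<Psi>\<close> with the rank-one map \<open>X \<mapsto> \<langle>X a, a\<rangle> b b\<^sup>*\<close> gives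
  \<open>\<langle>\<Psi> (a a\<^sup>*) b, b\<rangle>\<close>. Compressing a nonzero member of \<open>C\<close> from both sides shows that \<open>C\<close>
  contains all these maps, so its dual consists of positive maps; and they lie in the dual too, which is
  thus nonzero.
\<close>

section \<open>Positive semidefinite kernels\<close>

text \<open>The index set is a parameter: matrices use \<open>UNIV\<close>, block matrices use pairs
  (block, coordinate), and arguments can restrict to a subset or induct on it.\<close>

definition psd_kernel :: "'a set \<Rightarrow> ('a \<Rightarrow> 'a \<Rightarrow> complex) \<Rightarrow> bool" where
  "psd_kernel I K \<longleftrightarrow> (\<forall>w. (\<Sum>a\<in>I. \<Sum>b\<in>I. K a b * w b * cnj (w a)) \<in> \<real>\<^sub>\<ge>\<^sub>0)"

lemma psd_kernelD: "psd_kernel I K \<Longrightarrow> (\<Sum>a\<in>I. \<Sum>b\<in>I. K a b * w b * cnj (w a)) \<in> \<real>\<^sub>\<ge>\<^sub>0"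
  by (simp add: psd_kernel_def)

text \<open>Conjugate the test vector. Conjugate kernels arise because \<open>hs_inner\<close>
  conjugates its second argument.\<close>

lemma psd_kernel_cnj:
  assumes "psd_kernel I K"
  shows "psd_kernel I (\<lambda>a b. cnj (K a b))"
  unfolding psd_kernel_def
proof
  fix w
  have "(\<Sum>a\<in>I. \<Sum>b\<in>I. cnj (K a b) * w b * cnj (w a))
      = cnj (\<Sum>a\<in>I. \<Sum>b\<in>I. K a b * cnj (w b) * cnj (cnj (w a)))"
    by simp
  moreover have "cnj z \<in> \<real>\<^sub>\<ge>\<^sub>0" if "z \<in> \<real>\<^sub>\<ge>\<^sub>0" for z
    using that by (simp add: complex_nonneg_Reals_iff)
  ultimately show "(\<Sum>a\<in>I. \<Sum>b\<in>I. cnj (K a b) * w b * cnj (w a)) \<in> \<real>\<^sub>\<ge>\<^sub>0"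
    using psd_kernelD[OF assms, of "\<lambda>a. cnj (w a)"] by (simp only:)
qed

text \<open>Extend the test vector by zero outside \<open>J\<close>.\<close>

lemma psd_kernel_subset:
  assumes "psd_kernel I K" "J \<subseteq> I" "finite I"
  shows "psd_kernel J K"
  unfolding psd_kernel_def
proof
  fix w :: "'a \<Rightarrow> complex"
  let ?w = "\<lambda>a. if a \<in> J then w a else 0"
  have "(\<Sum>a\<in>I. \<Sum>b\<in>I. K a b * ?w b * cnj (?w a)) = (\<Sum>a\<in>J. \<Sum>b\<in>I. K a b * ?w b * cnj (?w a))"
    using assms by (intro sum.mono_neutral_right) auto
  also have "\<dots> = (\<Sum>a\<in>J. \<Sum>b\<in>J. K a b * ?w b * cnj (?w a))"
    using assms by (intro sum.cong refl sum.mono_neutral_right) auto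
  also have "\<dots> = (\<Sum>a\<in>J. \<Sum>b\<in>J. K a b * w b * cnj (w a))"
    by (intro sum.cong refl) auto
  finally show "(\<Sum>a\<in>J. \<Sum>b\<in>J. K a b * w b * cnj (w a)) \<in> \<real>\<^sub>\<ge>\<^sub>0"
    using psd_kernelD[OF assms(1), of ?w] by (simp only:)
qed

text \<open>The test vectors (1,0) and (0,1) handle the diagonal; (1,1) and (1,i) then compare the
  imaginary and the real parts of \<open>q\<close> and \<open>r\<close>.\<close>

lemma psd_two_by_two:
  fixes p q r u :: complex
  assumes H: "\<And>s t. p * s * cnj s + q * t * cnj s + (r * s * cnj t + u * t * cnj t) \<in> \<real>\<^sub>\<ge>\<^sub>0"
  shows "p \<in> \<real>\<^sub>\<ge>\<^sub>0" "r = cnj q" "p = 0 \<Longrightarrow> q = 0"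
proof -
  show p: "p \<in> \<real>\<^sub>\<ge>\<^sub>0" using H[of 1 0] by simp
  have u: "u \<in> \<real>\<^sub>\<ge>\<^sub>0" using H[of 0 1] by simp
  have 1: "Im q + Im r = 0"
    using H[of 1 1] p u by (simp add: complex_nonneg_Reals_iff)
  have 2: "Re q = Re r"
    using H[of 1 \<i>] p u by (simp add: complex_nonneg_Reals_iff)
  show r: "r = cnj q" using 1 2 by (simp add: complex_eq_iff)
  show "q = 0" if "p = 0"
  proof (rule ccontr)
    assume q: "q \<noteq> 0"
    define N where "N = (Re q)\<^sup>2 + (Im q)\<^sup>2"
    have N: "N > 0" using q by (auto simp: N_def complex_eq_iff sum_power2_gt_zero_iff)
    \<comment> \<open>For \<open>p = 0\<close> the vector with entries 1 and
      \<open>- e * cnj q\<close> gives the form the value \<open>e * N * (Re u * e - 2)\<close>. The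
      added 1 keeps \<open>e\<close> meaningful at \<open>u = 0\<close> and forces
      \<open>Re u * e < 1\<close>.\<close>
    define e where "e = inverse (Re u + 1)"
    have e: "e > 0" "Re u * e < 1"
      using u by (auto simp: e_def complex_nonneg_Reals_iff field_simps)
    have "0 \<le> - 2 * e * N + Re u * e * e * N"
      using H[of 1 "- of_real e * cnj q"] u \<open>p = 0\<close> r
      by (simp add: complex_nonneg_Reals_iff N_def power2_eq_square algebra_simps)
    also have "\<dots> = e * N * (Re u * e - 2)" by (simp add: algebra_simps)
    also have "\<dots> < 0" using e N by (intro mult_pos_neg) auto
    finally show False by simp
  qed
qed

lemma psd_kernel_diag:
  assumes "psd_kernel I K" "finite I" "a \<in> I"
  shows "K a a \<in> \<real>\<^sub>\<ge>\<^sub>0"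
  using psd_kernelD[OF psd_kernel_subset[OF assms(1), of "{a}"], of "\<lambda>_. 1"] assms by simp

text \<open>Restrict to the indices \<open>a\<close> and \<open>b\<close> and use the two-by-two
  case; \<open>a = b\<close> is separate, since \<open>{a,b}\<close> then has one element.\<close>

lemma psd_kernel_off_diag:
  assumes K: "psd_kernel I K" and "finite I" "a \<in> I" "b \<in> I"
  shows psd_kernel_hermitian: "K b a = cnj (K a b)"
    and psd_kernel_zero: "K a a = 0 \<Longrightarrow> K a b = 0"
proof -
  have "K b a = cnj (K a b) \<and> (K a a = 0 \<longrightarrow> K a b = 0)"
  proof (cases "a = b")
    case True
    then show ?thesis using psd_kernel_diag[of I K a] assms by (auto simp: complex_nonneg_Reals_iff complex_eq_iff)
  next
    case False
    have "K a a * s * cnj s + K a b * t * cnj s + (K b a * s * cnj t + K b b * t * cnj t) \<in> \<real>\<^sub>\<ge>\<^sub>0" for s t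
      using psd_kernelD[OF psd_kernel_subset[OF K, of "{a,b}"], of "\<lambda>c. if c = a then s else t"]
        assms False by simp
    from psd_two_by_two[OF this] show ?thesis by blast
  qed
  then show "K b a = cnj (K a b)" "K a a = 0 \<Longrightarrow> K a b = 0" by auto
qed

text \<open>A form that vanishes identically is in particular nonnegative; its diagonal vanishes,
  and a zero diagonal entry kills its row. This takes the place of polarization.\<close>

lemma kernel_eq_0:
  assumes "\<And>w. (\<Sum>a\<in>I. \<Sum>b\<in>I. K a b * w b * cnj (w a)) = 0" "finite I" "a \<in> I" "b \<in> I"
  shows "K a b = 0"
proof -
  have "psd_kernel I K" using assms by (simp add: psd_kernel_def)
  moreover have "K a a = 0"
  proof -
    let ?w = "\<lambda>c. if c = a then 1 else 0 :: complex"
    have "K c d * ?w d * cnj (?w c) = (if d = a then if c = a then K a a else 0 else 0)" for c d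
      by simp
    then have "(\<Sum>c\<in>I. \<Sum>d\<in>I. K c d * ?w d * cnj (?w c)) = K a a"
      using assms(2,3) by (simp only: sum.delta if_True)
    then show ?thesis using assms(1)[of ?w] by (simp only:)
  qed
  ultimately show ?thesis using psd_kernel_zero[of I K a b] assms(2-) by blast
qed

section \<open>Schur's theorem for the pairing of two kernels\<close>

lemma kernel_sum_insert:
  fixes K :: "'a \<Rightarrow> 'a \<Rightarrow> complex"
  assumes "finite I" "e \<notin> I"
  shows "(\<Sum>a\<in>insert e I. \<Sum>b\<in>insert e I. K a b * v b * cnj (v a))
    = K e e * v e * cnj (v e) + (\<Sum>b\<in>I. K e b * v b) * cnj (v e)
      + v e * (\<Sum>a\<in>I. K a e * cnj (v a)) + (\<Sum>a\<in>I. \<Sum>b\<in>I. K a b * v b * cnj (v a))"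
  by (simp only: sum.insert[OF assms] sum.distrib sum_distrib_left sum_distrib_right)
    (simp only: mult_ac add_ac)

text \<open>Induction on the index set; splitting off one index leaves the Schur complement of \<open>K\<close>.
  If the pivot vanishes, so does its row, and the junk value \<open>x / 0 = 0\<close> is the right one.\<close>

lemma psd_kernel_pairing:
  assumes "finite I" "psd_kernel I K" "psd_kernel I L"
  shows "(\<Sum>a\<in>I. \<Sum>b\<in>I. K a b * L a b) \<in> \<real>\<^sub>\<ge>\<^sub>0"
  using assms
proof (induction I arbitrary: K rule: finite_induct)
  case empty
  then show ?case by simp
next
  case (insert e I)
  note fin = \<open>finite I\<close> and e = \<open>e \<notin> I\<close> and K = \<open>psd_kernel (insert e I) K\<close>
  define \<kappa> where "\<kappa> = K e e"
  define K' where "K' a b = K a b - K a e * K e b / \<kappa>" for a b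
  have \<kappa>: "\<kappa> \<in> \<real>\<^sub>\<ge>\<^sub>0"
    unfolding \<kappa>_def using psd_kernel_diag[OF K, of e] fin by simp
  then have cnj_\<kappa>: "cnj \<kappa> = \<kappa>" by (simp add: complex_nonneg_Reals_iff complex_eq_iff)
  have herm: "K a e = cnj (K e a)" if "a \<in> insert e I" for a
    using psd_kernel_hermitian[OF K, of e a] that fin by simp
  have row: "\<kappa> = 0 \<Longrightarrow> K e a = 0" if "a \<in> insert e I" for a
    using psd_kernel_zero[OF K, of e a] that fin by (simp add: \<kappa>_def)
  have "psd_kernel I K'"
    unfolding psd_kernel_def
  proof
    fix w
    define S where "S = (\<Sum>b\<in>I. K e b * w b)"
    define T where "T = (\<Sum>a\<in>I. \<Sum>b\<in>I. K a b * w b * cnj (w a))"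
    \<comment> \<open>The coordinate at \<open>e\<close> completes the square: the form of
      \<open>K\<close> at \<open>v\<close> becomes the form of \<open>K'\<close> at
      \<open>w\<close>. For \<kappa> = 0 the coordinate is 0 and \<open>K'\<close> is just
      \<open>K\<close>, so this case agrees.\<close>
    define v where "v = w(e := - S / \<kappa>)"
    have cS: "(\<Sum>a\<in>I. K a e * cnj (w a)) = cnj S"
      unfolding S_def cnj_sum by (intro sum.cong refl) (simp add: herm)
    have v: "v e = - S / \<kappa>" "\<And>b. b \<in> I \<Longrightarrow> v b = w b"
      using e by (auto simp: v_def)
    have "(\<Sum>a\<in>insert e I. \<Sum>b\<in>insert e I. K a b * v b * cnj (v a))
        = K e e * v e * cnj (v e) + (\<Sum>b\<in>I. K e b * v b) * cnj (v e)
          + v e * (\<Sum>a\<in>I. K a e * cnj (v a)) + (\<Sum>a\<in>I. \<Sum>b\<in>I. K a b * v b * cnj (v a))"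
      using fin e by (rule kernel_sum_insert)
    also have "\<dots> = \<kappa> * (- S / \<kappa>) * cnj (- S / \<kappa>) + S * cnj (- S / \<kappa>)
          + (- S / \<kappa>) * (\<Sum>a\<in>I. K a e * cnj (w a)) + T"
      by (simp add: v T_def flip: S_def \<kappa>_def)
    also have "\<dots> = T - S * cnj S / \<kappa>"
      unfolding cS using cnj_\<kappa> by (cases "\<kappa> = 0") (simp_all add: field_simps)
    also have "\<dots> = (\<Sum>a\<in>I. \<Sum>b\<in>I. K' a b * w b * cnj (w a))"
    proof -
      have "S * cnj S / \<kappa> = (\<Sum>a\<in>I. \<Sum>b\<in>I. K a e * K e b / \<kappa> * w b * cnj (w a))"
        unfolding cS[symmetric]
        by (simp add: S_def sum_product sum_divide_distrib mult_ac, subst sum.swap)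
          (simp add: mult_ac)
      then show ?thesis
        by (simp add: T_def K'_def left_diff_distrib sum_subtractf)
    qed
    finally show "(\<Sum>a\<in>I. \<Sum>b\<in>I. K' a b * w b * cnj (w a)) \<in> \<real>\<^sub>\<ge>\<^sub>0"
      using psd_kernelD[OF K, of v] by (simp only:)
  qed
  moreover have "psd_kernel I L"
    using psd_kernel_subset[OF insert.prems(2)] fin by blast
  ultimately have IH: "(\<Sum>a\<in>I. \<Sum>b\<in>I. K' a b * L a b) \<in> \<real>\<^sub>\<ge>\<^sub>0"
    using insert.IH by blast
  \<comment> \<open>Row and column \<open>e\<close> of the Schur complement vanish, so pairing
    \<open>K'\<close> with \<open>L\<close> over \<open>insert e I\<close> reduces to the sum over
    \<open>I\<close> in \<open>IH\<close>.\<close>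
  have K'0: "K' a e = 0" "K' e a = 0" if "a \<in> insert e I" for a
  proof -
    have "\<kappa> = 0 \<Longrightarrow> K a e = 0" unfolding herm[OF that] using row[OF that] by simp
    then show "K' a e = 0" by (cases "\<kappa> = 0") (simp_all add: K'_def flip: \<kappa>_def)
    show "K' e a = 0" using row[OF that] by (cases "\<kappa> = 0") (simp_all add: K'_def flip: \<kappa>_def)
  qed
  \<comment> \<open>\<open>K\<close> is \<open>K'\<close> plus a rank-one kernel; pairing that
    kernel with \<open>L\<close> yields the quadratic form of \<open>L\<close> at the vector
    \<open>K e\<close>, divided by \<kappa>.\<close>
  have "(\<Sum>a\<in>insert e I. \<Sum>b\<in>insert e I. K a b * L a b)
      = (\<Sum>a\<in>insert e I. \<Sum>b\<in>insert e I. K' a b * L a b)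
        + (\<Sum>a\<in>insert e I. \<Sum>b\<in>insert e I. L a b * K e b * cnj (K e a)) / \<kappa>"
    unfolding sum_divide_distrib sum.distrib[symmetric]
  proof (intro sum.cong refl)
    fix a b assume "a \<in> insert e I"
    then have "cnj (K e a) = K a e" by (rule herm[symmetric])
    then show "K a b * L a b = K' a b * L a b + L a b * K e b * cnj (K e a) / \<kappa>"
      by (simp only: K'_def) (simp add: left_diff_distrib)
  qed
  also have "(\<Sum>a\<in>insert e I. \<Sum>b\<in>insert e I. K' a b * L a b) = (\<Sum>a\<in>I. \<Sum>b\<in>I. K' a b * L a b)"
    using fin e K'0 by simp
  finally have "(\<Sum>a\<in>insert e I. \<Sum>b\<in>insert e I. K a b * L a b) = (\<Sum>a\<in>I. \<Sum>b\<in>I. K' a b * L a b)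
      + (\<Sum>a\<in>insert e I. \<Sum>b\<in>insert e I. L a b * K e b * cnj (K e a)) / \<kappa>" .
  moreover have "(\<Sum>a\<in>insert e I. \<Sum>b\<in>insert e I. L a b * K e b * cnj (K e a)) / \<kappa> \<in> \<real>\<^sub>\<ge>\<^sub>0"
    using \<kappa> psd_kernelD[OF insert.prems(2), of "K e"] by (intro nonneg_Reals_divide_I)
  ultimately show ?case using IH by (simp only: nonneg_Reals_add_I)
qed

section \<open>Operators\<close>

definition rank_one :: "complex ^ 'k::finite \<Rightarrow> complex ^ 'k \<Rightarrow> 'k operator" where
  "rank_one x y = (\<chi> i j. x $ i * cnj (y $ j))"

abbreviation cscale :: "complex \<Rightarrow> 'k::finite operator \<Rightarrow> 'k operator" where
  "cscale c \<equiv> map_matrix ((*) c)"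

lemma matrix_unit_eq: "matrix_unit f k l = rank_one (f k) (f l)"
  by (simp add: matrix_unit_def rank_one_def)

lemma hs_inner_eq: "hs_inner A B = (\<Sum>i\<in>UNIV. \<Sum>j\<in>UNIV. A $ i $ j * cnj (B $ i $ j))"
  by (simp add: hs_inner_def trace_def matrix_matrix_mult_def adj_def)

lemma cnj_hs_inner: "cnj (hs_inner A B) = hs_inner B A"
  by (simp add: hs_inner_eq mult.commute)

lemma hs_inner_sum_left: "hs_inner (sum F S) B = (\<Sum>s\<in>S. hs_inner (F s) B)"
  by (induction S rule: infinite_finite_induct)
    (auto simp: hs_inner_eq sum.distrib algebra_simps)

lemma hs_inner_cscale_left: "hs_inner (cscale c A) B = c * hs_inner A B"
  by (simp add: hs_inner_eq sum_distrib_left mult_ac)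

lemma hs_inner_cscale_right: "hs_inner A (cscale c B) = cnj c * hs_inner A B"
  by (simp add: hs_inner_eq sum_distrib_left mult_ac)

lemma cinner_eq: "cinner (A *v y) x = (\<Sum>i\<in>UNIV. \<Sum>j\<in>UNIV. A $ i $ j * y $ j * cnj (x $ i))"
  by (simp add: cinner_def matrix_vector_mult_def sum_distrib_right)

text \<open>Turning quadratic forms into pairings with rank-one operators lets positivity pass
  through Hilbert-Schmidt adjoints.\<close>

lemma hs_inner_rank_one_right: "hs_inner A (rank_one x y) = cinner (A *v y) x"
  by (simp add: hs_inner_eq rank_one_def cinner_eq mult_ac)

lemma cnj_cinner: "cnj (cinner x y) = cinner y x"
  by (simp add: cinner_def mult.commute)

lemma rank_one_mult: "rank_one x y *v z = (\<chi> i. cinner z y * x $ i)"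
  by (simp add: rank_one_def matrix_vector_mult_def cinner_def vec_eq_iff sum_distrib_left mult_ac)

lemma psd_iff_kernel: "psd A \<longleftrightarrow> psd_kernel UNIV (\<lambda>i j. A $ i $ j)"
proof
  assume "psd A"
  then show "psd_kernel UNIV (\<lambda>i j. A $ i $ j)"
    unfolding psd_def psd_kernel_def cinner_eq
    by (metis (no_types, lifting) sum.cong vec_lambda_beta)
next
  assume "psd_kernel UNIV (\<lambda>i j. A $ i $ j)"
  then show "psd A"
    unfolding psd_def psd_kernel_def cinner_eq by blast
qed

section \<open>Positive semidefinite block matrices\<close>

text \<open>A family of \<open>d\<close> vectors is a single function on pairs (block, coordinate),
  so a block matrix flattens to one kernel.\<close>

lemma block_psd_iff_kernel:
  "block_psd d X \<longleftrightarrow> psd_kernel ({..<d} \<times> UNIV) (\<lambda>a b. X (fst a) (fst b) $ snd a $ snd b)"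
proof -
  have eq: "(\<Sum>i<d. \<Sum>j<d. cinner (X i j *v v j) (v i)) =
    (\<Sum>a\<in>{..<d}\<times>UNIV. \<Sum>b\<in>{..<d}\<times>UNIV. X (fst a) (fst b) $ snd a $ snd b * v (fst b) $ snd b
        * cnj (v (fst a) $ snd a))" for v
    unfolding cinner_eq sum.cartesian_product' fst_conv snd_conv
    by (intro sum.cong refl sum.swap)
  show ?thesis
  proof
    assume X: "block_psd d X"
    show "psd_kernel ({..<d} \<times> UNIV) (\<lambda>a b. X (fst a) (fst b) $ snd a $ snd b)"
      unfolding psd_kernel_def
    proof
      fix w :: "nat \<times> 'a \<Rightarrow> complex"
      show "(\<Sum>a\<in>{..<d} \<times> UNIV. \<Sum>b\<in>{..<d} \<times> UNIV.
          X (fst a) (fst b) $ snd a $ snd b * w b * cnj (w a)) \<in> \<real>\<^sub>\<ge>\<^sub>0"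
        using X[unfolded block_psd_def, rule_format, of "\<lambda>i. \<chi> p. w (i, p)"] unfolding eq by simp
    qed
  next
    assume "psd_kernel ({..<d} \<times> UNIV) (\<lambda>a b. X (fst a) (fst b) $ snd a $ snd b)"
    then show "block_psd d X"
      unfolding block_psd_def eq by (intro allI psd_kernelD)
  qed
qed

text \<open>After flattening, this is the Schur pairing of the kernel of \<open>X\<close> with the
  conjugated kernel of \<open>Y\<close>.\<close>

lemma block_psd_pairing:
  assumes "block_psd d X" "block_psd d Y"
  shows "(\<Sum>i<d. \<Sum>j<d. hs_inner (X i j) (Y i j)) \<in> \<real>\<^sub>\<ge>\<^sub>0"
proof -
  let ?I = "{..<d} \<times> (UNIV :: 'a set)"
  have "psd_kernel ?I (\<lambda>a b. cnj (Y (fst a) (fst b) $ snd a $ snd b))"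
    using assms(2) unfolding block_psd_iff_kernel by (rule psd_kernel_cnj)
  from psd_kernel_pairing[OF _ assms(1)[unfolded block_psd_iff_kernel] this]
  have "(\<Sum>a\<in>?I. \<Sum>b\<in>?I. X (fst a) (fst b) $ snd a $ snd b * cnj (Y (fst a) (fst b) $ snd a $ snd b)) \<in> \<real>\<^sub>\<ge>\<^sub>0"
    by simp
  also have "(\<Sum>a\<in>?I. \<Sum>b\<in>?I. X (fst a) (fst b) $ snd a $ snd b * cnj (Y (fst a) (fst b) $ snd a $ snd b))
     = (\<Sum>i<d. \<Sum>j<d. hs_inner (X i j) (Y i j))"
    unfolding hs_inner_eq sum.cartesian_product' fst_conv snd_conv
    by (intro sum.cong refl sum.swap)
  finally show ?thesis .
qed

text \<open>The block matrix is a column times its adjoint, so its form is the squared modulus of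
  one scalar.\<close>

lemma block_psd_rank_one: "block_psd d (\<lambda>i j. rank_one (v i) (v j))"
proof -
  have "(\<Sum>i<d. \<Sum>j<d. cinner (rank_one (v i) (v j) *v w j) (w i)) \<in> \<real>\<^sub>\<ge>\<^sub>0" for w
  proof -
    define S where "S = (\<Sum>i<d. cinner (v i) (w i))"
    have "cinner (rank_one (v i) (v j) *v w j) (w i) = cinner (v i) (w i) * cnj (cinner (v j) (w j))" for i j
      unfolding rank_one_mult cnj_cinner
      by (simp add: cinner_def[of "\<chi> i. _ i"] cinner_def[of "v i"] sum_distrib_left mult_ac)
    then have "(\<Sum>i<d. \<Sum>j<d. cinner (rank_one (v i) (v j) *v w j) (w i)) = S * cnj S"
      by (simp add: S_def sum_product)
    then show ?thesis by (simp add: complex_nonneg_Reals_iff)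
  qed
  then show ?thesis by (simp add: block_psd_def)
qed


section \<open>Superoperators\<close>

text \<open>Orthonormality says \<open>F ** G = mat 1\<close>; for square matrices the left inverse
  is also a right inverse, and \<open>G ** F = mat 1\<close> is the completeness relation.\<close>

lemma orthonormal_basis_complete:
  assumes "orthonormal_basis f"
  shows "(\<Sum>k\<in>UNIV. f k $ i * cnj (f k $ j)) = (if i = j then 1 else 0)"
proof -
  define F where "F = (\<chi> k i. cnj (f k $ i))"
  define G where "G = (\<chi> i k. f k $ i)"
  have "F ** G = mat 1"
    using assms by (auto simp: F_def G_def matrix_matrix_mult_def mat_def vec_eq_iff orthonormal_basis_def
        cinner_def mult.commute)
  then have "G ** F = mat 1" by (simp add: matrix_left_right_inverse)
  then have "(G ** F) $ i $ j = mat 1 $ i $ j" by simp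
  then show ?thesis by (simp add: F_def G_def matrix_matrix_mult_def mat_def)
qed

lemma matrix_unit_expansion:
  assumes "orthonormal_basis f"
  shows "X = (\<Sum>k\<in>UNIV. \<Sum>l\<in>UNIV. cscale (hs_inner X (matrix_unit f k l)) (matrix_unit f k l))"
proof -
  have "(\<Sum>k\<in>UNIV. \<Sum>l\<in>UNIV. hs_inner X (matrix_unit f k l) * matrix_unit f k l $ i $ j) = X $ i $ j" for i j
  proof -
    have "(\<Sum>k\<in>UNIV. \<Sum>l\<in>UNIV. hs_inner X (matrix_unit f k l) * matrix_unit f k l $ i $ j)
      = (\<Sum>k\<in>UNIV. \<Sum>l\<in>UNIV. \<Sum>p\<in>UNIV. \<Sum>q\<in>UNIV.
          X $ p $ q * (f k $ i * cnj (f k $ p)) * (f l $ q * cnj (f l $ j)))"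
      by (simp add: hs_inner_eq matrix_unit_def sum_distrib_left mult_ac)
    \<comment> \<open>The next two reorderings move \<open>k\<close> and \<open>l\<close> innermost,
      where the double sum factors and completeness applies to each factor.\<close>
    also have "\<dots> = (\<Sum>k\<in>UNIV. \<Sum>p\<in>UNIV. \<Sum>q\<in>UNIV. \<Sum>l\<in>UNIV.
          X $ p $ q * (f k $ i * cnj (f k $ p)) * (f l $ q * cnj (f l $ j)))"
      by (rule sum.cong[OF refl], subst sum.swap, rule sum.cong[OF refl], rule sum.swap)
    also have "\<dots> = (\<Sum>p\<in>UNIV. \<Sum>q\<in>UNIV. \<Sum>k\<in>UNIV. \<Sum>l\<in>UNIV.
          X $ p $ q * (f k $ i * cnj (f k $ p)) * (f l $ q * cnj (f l $ j)))"
      by (subst sum.swap, rule sum.cong[OF refl], rule sum.swap)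
    also have "\<dots> = (\<Sum>p\<in>UNIV. \<Sum>q\<in>UNIV. X $ p $ q * ((\<Sum>k\<in>UNIV. f k $ i * cnj (f k $ p)) *
         (\<Sum>l\<in>UNIV. f l $ q * cnj (f l $ j))))"
      by (simp only: sum_product) (simp only: sum_distrib_left mult.assoc)
    also have "\<dots> = X $ i $ j"
      unfolding orthonormal_basis_complete[OF assms]
      by (simp add: if_distrib[of cnj] mult_delta_left mult_delta_right)
    finally show ?thesis .
  qed
  then show ?thesis by (simp add: vec_eq_iff)
qed

lemma clinear_cscale: "\<Phi> \<in> clinear_maps \<Longrightarrow> blinfun_apply \<Phi> (cscale c X) = cscale c (blinfun_apply \<Phi> X)"
  by (simp add: clinear_maps_def)

lemma clinear_expansion:
  assumes "orthonormal_basis f" "\<Phi> \<in> clinear_maps"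
  shows "blinfun_apply \<Phi> X
    = (\<Sum>k\<in>UNIV. \<Sum>l\<in>UNIV. cscale (hs_inner X (matrix_unit f k l)) (blinfun_apply \<Phi> (matrix_unit f k l)))"
  by (subst matrix_unit_expansion[OF assms(1), of X])
    (simp only: blinfun.sum_right clinear_cscale[OF assms(2)])

lemma hs_inner_expansion:
  assumes "orthonormal_basis f" "\<Phi> \<in> clinear_maps"
  shows "hs_inner (blinfun_apply \<Phi> X) Y = (\<Sum>k\<in>UNIV. \<Sum>l\<in>UNIV.
    hs_inner X (matrix_unit f k l) * hs_inner (blinfun_apply \<Phi> (matrix_unit f k l)) Y)"
  by (subst clinear_expansion[OF assms]) (simp only: hs_inner_sum_left hs_inner_cscale_left)

lemma orthonormal_basis_axis: "orthonormal_basis (\<lambda>k. axis k 1)"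
  by (simp add: orthonormal_basis_def cinner_def axis_def if_distrib[of cnj] mult_delta_left mult_delta_right)

lemma hs_inner_matrix_unit_axis: "hs_inner X (matrix_unit (\<lambda>k. axis k 1) k l) = X $ k $ l"
proof -
  have "X $ i $ j * cnj (matrix_unit (\<lambda>k. axis k 1) k l $ i $ j)
      = (if j = l then if i = k then X $ k $ l else 0 else 0)" for i j
    by (simp add: matrix_unit_def axis_def)
  then show ?thesis by (simp add: hs_inner_eq)
qed

section \<open>Hilbert-Schmidt adjoints of superoperators\<close>

lemma map_inner_pairs:
  "map_inner f \<Phi> \<Psi> = (\<Sum>a\<in>UNIV. hs_inner (blinfun_apply \<Phi> (matrix_unit f (fst a) (snd a)))
     (blinfun_apply \<Psi> (matrix_unit f (fst a) (snd a))))"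
  by (simp add: map_inner_def sum.cartesian_product case_prod_unfold)

lemma cnj_map_inner: "cnj (map_inner f \<Phi> \<Psi>) = map_inner f \<Psi> \<Phi>"
  by (simp add: map_inner_def cnj_hs_inner)

text \<open>A relation suffices, as only the pairing identity is ever used.\<close>

definition adjoint_of :: "('k::finite, 'h::finite) superop \<Rightarrow> ('h, 'k) superop \<Rightarrow> bool" where
  "adjoint_of \<Omega> \<Theta> \<longleftrightarrow> (\<forall>X Y. hs_inner (blinfun_apply \<Omega> X) Y = hs_inner X (blinfun_apply \<Theta> Y))"

lemma adjoint_ofD:
  assumes "adjoint_of \<Omega> \<Theta>"
  shows "hs_inner (blinfun_apply \<Omega> X) Y = hs_inner X (blinfun_apply \<Theta> Y)"
    and "hs_inner Y (blinfun_apply \<Omega> X) = hs_inner (blinfun_apply \<Theta> Y) X"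
  using assms unfolding adjoint_of_def by (metis cnj_hs_inner)+

text \<open>Real scaling is complex scaling by \<open>of_real\<close>, so \<open>g\<close> is
  real-linear, hence bounded in finite dimension, and \<open>Blinfun g\<close> is not a junk
  value.\<close>

lemma Blinfun_in_clinear_maps:
  fixes g :: "'k::finite operator \<Rightarrow> 'h::finite operator"
  assumes add: "\<And>X Y. g (X + Y) = g X + g Y" and scale: "\<And>c X. g (cscale c X) = cscale c (g X)"
  shows "blinfun_apply (Blinfun g) = g" "Blinfun g \<in> clinear_maps"
proof -
  have sc: "r *\<^sub>R X = cscale (of_real r) X" for r and X :: "'n::finite operator"
    by (simp add: vec_eq_iff scaleR_conv_of_real[where 'a = complex])
  have "linear g" by (rule linearI) (simp_all add: add scale sc)
  then show *: "blinfun_apply (Blinfun g) = g"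
    by (simp add: bounded_linear_Blinfun_apply linear_conv_bounded_linear)
  show "Blinfun g \<in> clinear_maps" by (simp add: clinear_maps_def * scale)
qed

lemma adjoint_exists:
  fixes \<Omega> :: "('k::finite, 'h::finite) superop"
  assumes "\<Omega> \<in> clinear_maps"
  obtains \<Theta> where "\<Theta> \<in> clinear_maps" "adjoint_of \<Omega> \<Theta>"
proof -
  let ?E = "\<lambda>k l. matrix_unit (\<lambda>k. axis k 1) k l :: 'k operator"
  \<comment> \<open>The entries are forced: entry (i,j) of an operator is its pairing with
    \<open>?E i j\<close>, and the adjoint moves \<Omega> onto that unit.\<close>
  define g where "g Y = (\<chi> i j. hs_inner Y (blinfun_apply \<Omega> (?E i j)))" for Y
  have "g (X + Y) = g X + g Y" for X Y
    by (simp add: g_def vec_eq_iff hs_inner_eq sum.distrib algebra_simps)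
  moreover have "g (cscale c X) = cscale c (g X)" for c X
    by (simp add: g_def vec_eq_iff hs_inner_cscale_left)
  ultimately have g: "blinfun_apply (Blinfun g) = g" "Blinfun g \<in> clinear_maps"
    using Blinfun_in_clinear_maps by blast+
  have "hs_inner (blinfun_apply \<Omega> X) Y = hs_inner X (g Y)" for X Y
    by (subst hs_inner_expansion[OF orthonormal_basis_axis assms])
      (simp add: hs_inner_matrix_unit_axis hs_inner_eq[of X] g_def cnj_hs_inner)
  then show thesis using that[OF g(2)] by (simp add: adjoint_of_def g(1))
qed

lemma cp_mapsD: "\<Omega> \<in> cp_maps \<Longrightarrow> block_psd d X \<Longrightarrow> block_psd d (\<lambda>i j. blinfun_apply \<Omega> (X i j))"
  by (simp add: cp_maps_def)

text \<open>The form of the image block matrix at \<open>v\<close> is the pairing of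
  \<open>X\<close> with the image under \<Omega> of the block matrix
  \<open>rank_one (v i) (v j)\<close>; both are positive.\<close>

lemma adjoint_of_cp_maps:
  assumes "\<Omega> \<in> cp_maps" "\<Theta> \<in> clinear_maps" "adjoint_of \<Omega> \<Theta>"
  shows "\<Theta> \<in> cp_maps"
proof -
  have "block_psd d (\<lambda>i j. blinfun_apply \<Theta> (X i j))" if "block_psd d X" for d X
    unfolding block_psd_def
  proof
    fix v
    have "cinner (blinfun_apply \<Theta> (X i j) *v v j) (v i)
        = hs_inner (X i j) (blinfun_apply \<Omega> (rank_one (v i) (v j)))" for i j
      by (simp add: adjoint_ofD(2)[OF assms(3)] hs_inner_rank_one_right)
    then show "(\<Sum>i<d. \<Sum>j<d. cinner (blinfun_apply \<Theta> (X i j) *v v j) (v i)) \<in> \<real>\<^sub>\<ge>\<^sub>0"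
      using block_psd_pairing[OF that cp_mapsD[OF assms(1) block_psd_rank_one[of d v]]] by simp
  qed
  then show ?thesis using assms(2) by (simp add: cp_maps_def)
qed

lemma map_inner_compose_left:
  assumes "adjoint_of \<Upsilon> \<Theta>"
  shows "map_inner f (\<Upsilon> o\<^sub>L \<Psi>) \<Phi> = map_inner f \<Psi> (\<Theta> o\<^sub>L \<Phi>)"
  by (simp add: map_inner_def adjoint_ofD[OF assms])

text \<open>Expanding in the basis turns both sides into the same double sum over matrix units, with
  coefficients moved from \<Omega> to \<Theta> by adjointness.\<close>

lemma map_inner_compose_right:
  assumes f: "orthonormal_basis f" and "adjoint_of \<Omega> \<Theta>" "\<Psi> \<in> clinear_maps" "\<Phi> \<in> clinear_maps"
  shows "map_inner f (\<Psi> o\<^sub>L \<Omega>) \<Phi> = map_inner f \<Psi> (\<Phi> o\<^sub>L \<Theta>)"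
proof -
  let ?E = "\<lambda>a. matrix_unit f (fst a) (snd a)"
  have exp: "hs_inner (blinfun_apply \<Xi> X) Y = (\<Sum>b\<in>UNIV. hs_inner X (?E b) * hs_inner (blinfun_apply \<Xi> (?E b)) Y)"
    if "\<Xi> \<in> clinear_maps" for \<Xi> :: "('a, 'b) superop" and X Y
    by (subst hs_inner_expansion[OF f that]) (simp add: sum.cartesian_product case_prod_unfold)
  have "map_inner f (\<Psi> o\<^sub>L \<Omega>) \<Phi> = (\<Sum>a\<in>UNIV. \<Sum>b\<in>UNIV.
      hs_inner (blinfun_apply \<Omega> (?E a)) (?E b) * hs_inner (blinfun_apply \<Psi> (?E b)) (blinfun_apply \<Phi> (?E a)))"
    by (simp add: map_inner_pairs exp[OF assms(3), of "blinfun_apply \<Omega> _"])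
  also have "\<dots> = (\<Sum>b\<in>UNIV. \<Sum>a\<in>UNIV.
      hs_inner (blinfun_apply \<Omega> (?E a)) (?E b) * hs_inner (blinfun_apply \<Psi> (?E b)) (blinfun_apply \<Phi> (?E a)))"
    by (rule sum.swap)
  \<comment> \<open>The expansion acts on the first argument only; conjugating brings \<Phi>
    there.\<close>
  also have "\<dots> = (\<Sum>b\<in>UNIV. cnj (hs_inner (blinfun_apply \<Phi> (blinfun_apply \<Theta> (?E b))) (blinfun_apply \<Psi> (?E b))))"
    by (simp add: exp[OF assms(4), of "blinfun_apply \<Theta> _"] cnj_hs_inner adjoint_ofD[OF assms(2)])
  also have "\<dots> = map_inner f \<Psi> (\<Phi> o\<^sub>L \<Theta>)"
    by (simp add: map_inner_pairs cnj_hs_inner)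
  finally show ?thesis .
qed

section \<open>Complete positivity implies Hermiticity preservation\<close>

lemma adj_nth: "adj A $ i $ j = cnj (A $ j $ i)"
  by (simp add: adj_def)

lemma cp_maps_subset_hp_maps: "(cp_maps :: ('k::finite, 'h::finite) superop set) \<subseteq> hp_maps"
proof
  fix \<Omega> :: "('k, 'h) superop"
  assume cp: "\<Omega> \<in> cp_maps"
  then have lin: "\<Omega> \<in> clinear_maps" by (simp add: cp_maps_def)
  let ?E = "\<lambda>k l. matrix_unit (\<lambda>k. axis k 1) k l :: 'k operator"
  have E: "blinfun_apply \<Omega> (?E l k) = adj (blinfun_apply \<Omega> (?E k l))" for k l
  proof -
    \<comment> \<open>The 2 x 2 block matrix \<open>rank_one (v i) (v j)\<close> has
      \<open>?E k l\<close> and \<open>?E l k\<close> off the diagonal. Its image is positive, hence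
      Hermitian, which relates the two off-diagonal blocks.\<close>
    define v where "v i = (axis (if i = 0 then k else l) 1 :: complex ^ 'k)" for i :: nat
    have "psd_kernel ({..<2} \<times> UNIV)
        (\<lambda>a b. blinfun_apply \<Omega> (rank_one (v (fst a)) (v (fst b))) $ snd a $ snd b)"
      using cp_mapsD[OF cp block_psd_rank_one[of 2 v]] by (simp add: block_psd_iff_kernel)
    from psd_kernel_hermitian[OF this, of "(0, q)" "(1, p)" for p q]
    show ?thesis
      by (simp add: vec_eq_iff adj_nth v_def matrix_unit_eq)
  qed
  have "blinfun_apply \<Omega> (adj X) = adj (blinfun_apply \<Omega> X)" for X
  proof -
    have "blinfun_apply \<Omega> (adj X) $ i $ j = cnj (blinfun_apply \<Omega> X $ j $ i)" for i j
    proof -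
      have "blinfun_apply \<Omega> (adj X) $ i $ j = (\<Sum>k\<in>UNIV. \<Sum>l\<in>UNIV. cnj (X $ l $ k) * blinfun_apply \<Omega> (?E k l) $ i $ j)"
        by (subst clinear_expansion[OF orthonormal_basis_axis lin])
          (simp add: hs_inner_matrix_unit_axis adj_nth)
      also have "\<dots> = (\<Sum>l\<in>UNIV. \<Sum>k\<in>UNIV. cnj (X $ l $ k) * cnj (blinfun_apply \<Omega> (?E l k) $ j $ i))"
        by (subst sum.swap, intro sum.cong refl, subst E) (simp add: adj_nth)
      also have "\<dots> = cnj (blinfun_apply \<Omega> X $ j $ i)"
        by (subst clinear_expansion[OF orthonormal_basis_axis lin, of X])
          (simp add: hs_inner_matrix_unit_axis)
      finally show ?thesis .
    qed
    then show ?thesis by (simp add: vec_eq_iff adj_nth)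
  qed
  with lin show "\<Omega> \<in> hp_maps" by (simp add: hp_maps_def)
qed

section \<open>Rank-one superoperators\<close>

text \<open>This is conjugation by the single Kraus operator \<open>rank_one b a\<close>.\<close>

definition rank_one_map :: "complex ^ 'k::finite \<Rightarrow> complex ^ 'h::finite \<Rightarrow> ('k, 'h) superop" where
  "rank_one_map a b = Blinfun (\<lambda>X. cscale (cinner (X *v a) a) (rank_one b b))"

lemma rank_one_map:
  shows rank_one_map_apply: "blinfun_apply (rank_one_map a b) X = cscale (cinner (X *v a) a) (rank_one b b)"
    and rank_one_map_clinear: "rank_one_map a b \<in> clinear_maps"
proof -
  let ?g = "\<lambda>X. cscale (cinner (X *v a) a) (rank_one b b)"
  have "cinner ((X + Y) *v a) a = cinner (X *v a) a + cinner (Y *v a) a" for X Y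
    by (simp add: cinner_eq sum.distrib distrib_right)
  moreover have "cinner (cscale c X *v a) a = c * cinner (X *v a) a" for c X
    by (simp add: cinner_eq sum_distrib_left mult.assoc)
  ultimately have "?g (X + Y) = ?g X + ?g Y" "?g (cscale c X) = cscale c (?g X)" for X Y c
    by (simp_all add: vec_eq_iff distrib_right mult.assoc)
  note g = Blinfun_in_clinear_maps[of ?g, OF this]
  show "blinfun_apply (rank_one_map a b) X = ?g X" "rank_one_map a b \<in> clinear_maps"
    using g by (simp_all add: rank_one_map_def)
qed

text \<open>The form of the image at \<open>v\<close> is the form of \<open>X\<close> at the vectors
  \<open>cinner (v i) b\<close> times \<open>a\<close>.\<close>

lemma rank_one_map_cp: "rank_one_map a b \<in> cp_maps"
proof -
  have "block_psd d (\<lambda>i j. blinfun_apply (rank_one_map a b) (X i j))" if X: "block_psd d X" for d X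
    unfolding block_psd_def
  proof
    fix v :: "nat \<Rightarrow> complex ^ 'b"
    have "cinner (blinfun_apply (rank_one_map a b) (X i j) *v v j) (v i)
        = cinner (X i j *v (\<chi> p. cinner (v j) b * a $ p)) (\<chi> p. cinner (v i) b * a $ p)" for i j
    proof -
      have "cinner (blinfun_apply (rank_one_map a b) (X i j) *v v j) (v i)
          = cinner (X i j *v a) a * hs_inner (rank_one b b) (rank_one (v i) (v j))"
        by (simp add: rank_one_map_apply hs_inner_cscale_left flip: hs_inner_rank_one_right)
      also have "hs_inner (rank_one b b) (rank_one (v i) (v j)) = cinner (v j) b * cinner b (v i)"
        unfolding hs_inner_rank_one_right rank_one_mult
        by (simp add: cinner_def[of "\<chi> i. _ i"] cinner_def[of b] sum_distrib_left mult_ac)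
      also have "cinner b (v i) = cnj (cinner (v i) b)" by (simp add: cnj_cinner)
      finally show ?thesis
        by (simp add: cinner_eq sum_distrib_right sum_distrib_left mult_ac)
    qed
    then show "(\<Sum>i<d. \<Sum>j<d. cinner (blinfun_apply (rank_one_map a b) (X i j) *v v j) (v i)) \<in> \<real>\<^sub>\<ge>\<^sub>0"
      using X[unfolded block_psd_def, rule_format, of "\<lambda>i. \<chi> p. cinner (v i) b * a $ p"] by simp
  qed
  then show ?thesis using rank_one_map_clinear by (simp add: cp_maps_def)
qed

text \<open>Expand \<open>rank_one a a\<close> in matrix units: its coefficients are exactly the
  conjugated scalars that \<open>rank_one_map a b\<close> contributes to the second
  argument.\<close>

lemma map_inner_rank_one_map_right:
  assumes "orthonormal_basis f" "\<Psi> \<in> clinear_maps"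
  shows "map_inner f \<Psi> (rank_one_map a b) = cinner (blinfun_apply \<Psi> (rank_one a a) *v b) b"
proof -
  have "cinner (blinfun_apply \<Psi> (rank_one a a) *v b) b
     = hs_inner (blinfun_apply \<Psi> (rank_one a a)) (rank_one b b)"
    by (simp add: hs_inner_rank_one_right)
  also have "\<dots> = (\<Sum>k\<in>UNIV. \<Sum>l\<in>UNIV. hs_inner (rank_one a a) (matrix_unit f k l)
      * hs_inner (blinfun_apply \<Psi> (matrix_unit f k l)) (rank_one b b))"
    by (rule hs_inner_expansion[OF assms])
  also have "\<dots> = map_inner f \<Psi> (rank_one_map a b)"
    unfolding map_inner_def rank_one_map_apply hs_inner_cscale_right hs_inner_rank_one_right[symmetric] cnj_hs_inner ..
  finally show ?thesis ..
qed

section \<open>Testing maps on rank-one operators\<close>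

lemma psd_rank_one: "psd (rank_one a a)"
  using block_psd_rank_one[of 1 "\<lambda>_. a"] unfolding block_psd_def psd_def by (auto dest: spec[of _ "\<lambda>_. _"])

text \<open>The vanishing-kernel argument is used twice: in the vector \<open>w\<close>, then in the
  coordinates of \<open>v\<close>. It supplies a nonzero scalar for every nonzero map.\<close>

lemma clinear_eq_0:
  assumes lin: "\<Phi> \<in> clinear_maps" and 0: "\<And>v w. cinner (blinfun_apply \<Phi> (rank_one v v) *v w) w = 0"
  shows "\<Phi> = 0"
proof -
  let ?E = "\<lambda>k l. matrix_unit (\<lambda>k. axis k 1) k l :: 'a operator"
  have 1: "blinfun_apply \<Phi> (rank_one v v) = 0" for v
  proof -
    have "blinfun_apply \<Phi> (rank_one v v) $ i $ j = 0" for i j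
    proof (rule kernel_eq_0[where I = UNIV and K = "\<lambda>i j. blinfun_apply \<Phi> (rank_one v v) $ i $ j"])
      show "(\<Sum>a\<in>UNIV. \<Sum>c\<in>UNIV. blinfun_apply \<Phi> (rank_one v v) $ a $ c * w c * cnj (w a)) = 0" for w
        using 0[of v "\<chi> i. w i"] by (simp add: cinner_eq)
    qed auto
    then show ?thesis by (simp add: vec_eq_iff)
  qed
  have 2: "blinfun_apply \<Phi> (?E k l) $ i $ j = 0" for i j k l
  \<comment> \<open>The indices of the kernel are swapped because \<open>rank_one\<close> conjugates
    its second factor, whereas a kernel form conjugates at the first index.\<close>
  proof (rule kernel_eq_0[where I = UNIV and K = "\<lambda>l k. blinfun_apply \<Phi> (?E k l) $ i $ j"])
    fix w :: "'a \<Rightarrow> complex"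
    have "0 = blinfun_apply \<Phi> (rank_one (\<chi> i. w i) (\<chi> i. w i)) $ i $ j" by (simp add: 1)
    also have "\<dots> = (\<Sum>k\<in>UNIV. \<Sum>l\<in>UNIV. blinfun_apply \<Phi> (?E k l) $ i $ j * w k * cnj (w l))"
      by (subst clinear_expansion[OF orthonormal_basis_axis lin])
        (simp add: hs_inner_matrix_unit_axis rank_one_def mult_ac)
    also have "\<dots> = (\<Sum>l\<in>UNIV. \<Sum>k\<in>UNIV. blinfun_apply \<Phi> (?E k l) $ i $ j * w k * cnj (w l))"
      by (rule sum.swap)
    finally show "(\<Sum>l\<in>UNIV. \<Sum>k\<in>UNIV. blinfun_apply \<Phi> (?E k l) $ i $ j * w k * cnj (w l)) = 0" by simp
  qed auto
  show ?thesis
  proof (rule blinfun_eqI)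
    fix X
    have "blinfun_apply \<Phi> X $ i $ j = 0" for i j
      by (subst clinear_expansion[OF orthonormal_basis_axis lin]) (simp add: 2)
    then show "blinfun_apply \<Phi> X = blinfun_apply 0 X" by (simp add: vec_eq_iff)
  qed
qed

text \<open>No spectral decomposition is involved: the form of the image of \<open>X\<close> at
  \<open>w\<close> is the Schur pairing of \<open>X\<close> with the kernel of forms of
  \<open>\<Psi> (?E k l)\<close> at \<open>w\<close>, positive by the rank-one hypothesis.\<close>

lemma positive_mapsI:
  assumes lin: "\<Psi> \<in> clinear_maps" and pos: "\<And>v. psd (blinfun_apply \<Psi> (rank_one v v))"
  shows "\<Psi> \<in> positive_maps"
proof -
  let ?E = "\<lambda>k l. matrix_unit (\<lambda>k. axis k 1) k l :: 'a operator"
  have expand: "cinner (blinfun_apply \<Psi> X *v w) w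
      = (\<Sum>k\<in>UNIV. \<Sum>l\<in>UNIV. X $ k $ l * cinner (blinfun_apply \<Psi> (?E k l) *v w) w)" for X w
    using hs_inner_expansion[OF orthonormal_basis_axis lin, of X "rank_one w w"]
    by (simp add: hs_inner_matrix_unit_axis hs_inner_rank_one_right)
  have "cinner (blinfun_apply \<Psi> X *v w) w \<in> \<real>\<^sub>\<ge>\<^sub>0" if "psd X" for X w
  proof (subst expand, rule psd_kernel_pairing)
    show "psd_kernel UNIV (\<lambda>k l. X $ k $ l)" using that by (simp add: psd_iff_kernel)
    show "psd_kernel UNIV (\<lambda>k l. cinner (blinfun_apply \<Psi> (?E k l) *v w) w)"
      unfolding psd_kernel_def
    proof
      fix z
      \<comment> \<open>Conjugating \<open>z\<close> puts the conjugate at the first index, as the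
        kernel form requires.\<close>
      have "cinner (blinfun_apply \<Psi> (rank_one (\<chi> i. cnj (z i)) (\<chi> i. cnj (z i))) *v w) w \<in> \<real>\<^sub>\<ge>\<^sub>0"
        using pos unfolding psd_def by blast
      then show "(\<Sum>a\<in>UNIV. \<Sum>b\<in>UNIV. cinner (blinfun_apply \<Psi> (?E a b) *v w) w * z b * cnj (z a)) \<in> \<real>\<^sub>\<ge>\<^sub>0"
        by (subst (asm) expand) (simp add: rank_one_def mult_ac)
    qed
  qed auto
  then show ?thesis using lin by (simp add: positive_maps_def psd_def)
qed

text \<open>The sandwich is a scalar multiple of \<open>rank_one_map a b\<close>: the inner map
  outputs multiples of \<open>rank_one v v\<close>, the outer one reads off the form at
  \<open>w\<close>. The scalar comes out conjugated from the second argument.\<close>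

lemma map_inner_sandwich:
  assumes "\<Phi> \<in> clinear_maps"
  shows "map_inner f \<Psi> (rank_one_map w b o\<^sub>L \<Phi> o\<^sub>L rank_one_map a v)
    = cnj (cinner (blinfun_apply \<Phi> (rank_one v v) *v w) w) * map_inner f \<Psi> (rank_one_map a b)"
proof -
  have "blinfun_apply (rank_one_map w b o\<^sub>L \<Phi> o\<^sub>L rank_one_map a v) X
      = cscale (cinner (blinfun_apply \<Phi> (rank_one v v) *v w) w) (blinfun_apply (rank_one_map a b) X)" for X
    by (simp add: rank_one_map_apply clinear_cscale[OF assms] vec_eq_iff hs_inner_cscale_left mult_ac
        flip: hs_inner_rank_one_right)
  then show ?thesis
    by (simp add: map_inner_def hs_inner_cscale_right sum_distrib_left)
qed

text \<open>The identity is sent to a matrix whose (j,j) entry is 1.\<close>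

lemma rank_one_map_neq_0: "rank_one_map (axis i 1) (axis j 1) \<noteq> 0"
proof
  assume "rank_one_map (axis i 1) (axis j 1) = (0 :: ('a, 'b) superop)"
  then have "blinfun_apply (rank_one_map (axis i 1) (axis j 1)) (mat 1) $ j $ j = 0" by simp
  moreover have "cinner (axis i 1) (axis i 1 :: complex ^ 'a) = 1"
    by (simp add: orthonormal_basis_axis[unfolded orthonormal_basis_def, rule_format])
  ultimately show False by (simp add: rank_one_map_apply rank_one_def)
qed

section \<open>The dual cone\<close>

lemma positive_maps_clinear: "\<Phi> \<in> positive_maps \<Longrightarrow> \<Phi> \<in> clinear_maps"
  by (simp add: positive_maps_def)

lemma hp_maps_clinear: "\<Phi> \<in> hp_maps \<Longrightarrow> \<Phi> \<in> clinear_maps"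
  by (simp add: hp_maps_def)

lemma cp_maps_clinear: "\<Phi> \<in> cp_maps \<Longrightarrow> \<Phi> \<in> clinear_maps"
  by (simp add: cp_maps_def)

lemma hp_maps_compose: "\<Phi> \<in> hp_maps \<Longrightarrow> \<Psi> \<in> hp_maps \<Longrightarrow> \<Phi> o\<^sub>L \<Psi> \<in> hp_maps"
  by (simp add: hp_maps_def clinear_maps_def)

text \<open>Scalar equations between continuous functions of \<Phi> make closedness
  immediate.\<close>

lemma hp_maps_iff: "\<Phi> \<in> hp_maps \<longleftrightarrow>
    (\<forall>c X i j. blinfun_apply \<Phi> (cscale c X) $ i $ j = c * blinfun_apply \<Phi> X $ i $ j) \<and>
    (\<forall>X i j. blinfun_apply \<Phi> (adj X) $ i $ j = cnj (blinfun_apply \<Phi> X $ j $ i))"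
  by (simp add: hp_maps_def clinear_maps_def vec_eq_iff adj_nth)

lemma mcs_cone_compose:
  "mcs_cone C \<Longrightarrow> \<Phi> \<in> C \<Longrightarrow> \<Upsilon> \<in> cp_maps \<Longrightarrow> \<Omega> \<in> cp_maps \<Longrightarrow> \<Upsilon> o\<^sub>L \<Phi> o\<^sub>L \<Omega> \<in> C"
  by (simp add: mcs_cone_def)

section \<open>Closedness and convexity of the dual\<close>

lemma closed_hp_maps: "closed hp_maps"
proof -
  have "closed {\<Phi>. (\<forall>c X i j. blinfun_apply \<Phi> (cscale c X) $ i $ j = c * blinfun_apply \<Phi> X $ i $ j) \<and>
    (\<forall>X i j. blinfun_apply \<Phi> (adj X) $ i $ j = cnj (blinfun_apply \<Phi> X $ j $ i))}"
    by (intro closed_Collect_conj closed_Collect_all closed_Collect_eq continuous_intros)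
  then show ?thesis by (simp add: hp_maps_iff[symmetric])
qed

lemma closed_dual_cone: "closed (dual_cone f C)"
proof -
  have "closed {\<Psi>. map_inner f \<Psi> \<Phi> \<in> \<real>\<^sub>\<ge>\<^sub>0}" for \<Phi>
    unfolding map_inner_def hs_inner_eq complex_nonneg_Reals_iff
    by (intro closed_Collect_conj closed_Collect_le closed_Collect_eq continuous_intros)
  then have "closed (hp_maps \<inter> (\<Inter>\<Phi>\<in>C. {\<Psi>. map_inner f \<Psi> \<Phi> \<in> \<real>\<^sub>\<ge>\<^sub>0}))"
    by (intro closed_Int closed_hp_maps closed_INT) auto
  moreover have "dual_cone f C = hp_maps \<inter> (\<Inter>\<Phi>\<in>C. {\<Psi>. map_inner f \<Psi> \<Phi> \<in> \<real>\<^sub>\<ge>\<^sub>0})"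
    by (auto simp: dual_cone_def)
  ultimately show ?thesis by simp
qed

lemma convex_cone_dual_cone: "convex_cone (dual_cone f C)"
  unfolding convex_cone_iff
proof (intro conjI ballI allI impI)
  show "0 \<in> dual_cone f C"
    by (simp add: dual_cone_def hp_maps_iff map_inner_def hs_inner_eq)
next
  fix \<Phi> \<Psi> assume "\<Phi> \<in> dual_cone f C" "\<Psi> \<in> dual_cone f C"
  moreover have "map_inner f (\<Phi> + \<Psi>) \<Xi> = map_inner f \<Phi> \<Xi> + map_inner f \<Psi> \<Xi>" for \<Xi>
    by (simp add: map_inner_def hs_inner_eq sum.distrib algebra_simps blinfun.add_left)
  ultimately show "\<Phi> + \<Psi> \<in> dual_cone f C"
    by (simp add: dual_cone_def hp_maps_iff blinfun.add_left algebra_simps)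
next
  fix \<Phi> and c :: real assume "\<Phi> \<in> dual_cone f C" "0 \<le> c"
  moreover have "map_inner f (c *\<^sub>R \<Phi>) \<Xi> = of_real c * map_inner f \<Phi> \<Xi>" for \<Xi>
    by (simp add: map_inner_def hs_inner_eq sum_distrib_left blinfun.scaleR_left scaleR_conv_of_real[where 'a = complex] mult_ac)
  ultimately show "c *\<^sub>R \<Phi> \<in> dual_cone f C"
    by (simp add: dual_cone_def hp_maps_iff blinfun.scaleR_left scaleR_conv_of_real[where 'a = complex])
qed

section \<open>Positivity, nontriviality and symmetry of the dual\<close>

lemma positive_maps_rank_one:
  assumes "\<Phi> \<in> positive_maps"
  shows "cinner (blinfun_apply \<Phi> (rank_one a a) *v b) b \<in> \<real>\<^sub>\<ge>\<^sub>0"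
proof -
  have "psd (blinfun_apply \<Phi> (rank_one a a))"
    using assms psd_rank_one[of a] by (simp add: positive_maps_def)
  then show ?thesis by (simp add: psd_def)
qed

lemma map_inner_rank_one_map_nonneg:
  assumes "orthonormal_basis f" "\<Phi> \<in> positive_maps"
  shows "map_inner f \<Phi> (rank_one_map a b) \<in> \<real>\<^sub>\<ge>\<^sub>0"
  unfolding map_inner_rank_one_map_right[OF assms(1) positive_maps_clinear[OF assms(2)]]
  using assms(2) by (rule positive_maps_rank_one)

text \<open>Exchanging the arguments only conjugates the pairing, which is a nonnegative real
  because members of \<open>C\<close> are positive.\<close>

lemma rank_one_map_in_dual_cone:
  assumes "orthonormal_basis f" "C \<subseteq> positive_maps"
  shows "rank_one_map a b \<in> dual_cone f C"
proof -
  have "map_inner f (rank_one_map a b) \<Phi> \<in> \<real>\<^sub>\<ge>\<^sub>0" if "\<Phi> \<in> C" for \<Phi>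
    using map_inner_rank_one_map_nonneg[OF assms(1), of \<Phi> a b] that assms(2)
    by (subst cnj_map_inner[symmetric]) (auto simp: complex_nonneg_Reals_iff)
  then show ?thesis
    using subsetD[OF cp_maps_subset_hp_maps rank_one_map_cp] by (simp add: dual_cone_def)
qed

text \<open>Sandwiching a nonzero \<open>\<Phi> \<in> C\<close> between rank-one maps puts a positive multiple of every
  rank-one map into \<open>C\<close>, and these test positivity of \<open>\<Psi>\<close>.\<close>

lemma dual_cone_subset_positive_maps:
  assumes f: "orthonormal_basis f" and C: "mcs_cone C"
  shows "dual_cone f C \<subseteq> positive_maps"
proof
  fix \<Psi> assume \<Psi>: "\<Psi> \<in> dual_cone f C"
  then have lin: "\<Psi> \<in> clinear_maps" by (simp add: dual_cone_def hp_maps_def)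
  have "C \<noteq> {}" "C \<noteq> {0}" using C by (auto simp: mcs_cone_def convex_cone_def)
  then obtain \<Phi> where \<Phi>: "\<Phi> \<in> C" "\<Phi> \<noteq> 0" by blast
  with C have pos: "\<Phi> \<in> positive_maps" by (auto simp: mcs_cone_def)
  obtain v w where "cinner (blinfun_apply \<Phi> (rank_one v v) *v w) w \<noteq> 0"
    using clinear_eq_0[OF positive_maps_clinear[OF pos]] \<Phi>(2) by blast
  moreover define \<gamma> where "\<gamma> = cinner (blinfun_apply \<Phi> (rank_one v v) *v w) w"
  moreover have "\<gamma> \<in> \<real>\<^sub>\<ge>\<^sub>0"
    unfolding \<gamma>_def using pos by (rule positive_maps_rank_one)
  ultimately have \<gamma>: "\<gamma> \<noteq> 0" "\<gamma> \<in> \<real>\<^sub>\<ge>\<^sub>0" "cnj \<gamma> = \<gamma>"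
    by (auto simp: complex_nonneg_Reals_iff complex_eq_iff)
  show "\<Psi> \<in> positive_maps"
  proof (rule positive_mapsI[OF lin])
    fix a
    have "cinner (blinfun_apply \<Psi> (rank_one a a) *v b) b \<in> \<real>\<^sub>\<ge>\<^sub>0" for b
    proof -
      have "rank_one_map w b o\<^sub>L \<Phi> o\<^sub>L rank_one_map a v \<in> C"
        using C \<Phi>(1) by (intro mcs_cone_compose rank_one_map_cp)
      then have "\<gamma> * map_inner f \<Psi> (rank_one_map a b) \<in> \<real>\<^sub>\<ge>\<^sub>0"
        using \<Psi> map_inner_sandwich[OF positive_maps_clinear[OF pos], of f \<Psi> w b a v] \<gamma>(3)
        by (auto simp: dual_cone_def \<gamma>_def)
      from nonneg_Reals_mult_I[OF nonneg_Reals_inverse_I[OF \<gamma>(2)] this]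
      have "inverse \<gamma> * (\<gamma> * map_inner f \<Psi> (rank_one_map a b)) \<in> \<real>\<^sub>\<ge>\<^sub>0" .
      then show ?thesis
        using \<gamma>(1) map_inner_rank_one_map_right[OF f lin] by (simp add: mult.assoc[symmetric])
    qed
    then show "psd (blinfun_apply \<Psi> (rank_one a a))" by (simp add: psd_def)
  qed
qed

lemma dual_cone_compose:
  assumes f: "orthonormal_basis f" and C: "mcs_cone C"
    and \<Psi>: "\<Psi> \<in> dual_cone f C" and \<Upsilon>: "\<Upsilon> \<in> cp_maps" and \<Omega>: "\<Omega> \<in> cp_maps"
  shows "\<Upsilon> o\<^sub>L \<Psi> o\<^sub>L \<Omega> \<in> dual_cone f C"
proof -
  obtain \<Upsilon>' where \<Upsilon>': "\<Upsilon>' \<in> clinear_maps" "adjoint_of \<Upsilon> \<Upsilon>'"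
    using adjoint_exists[OF cp_maps_clinear[OF \<Upsilon>]] .
  obtain \<Omega>' where \<Omega>': "\<Omega>' \<in> clinear_maps" "adjoint_of \<Omega> \<Omega>'"
    using adjoint_exists[OF cp_maps_clinear[OF \<Omega>]] .
  have hp: "\<Upsilon> o\<^sub>L \<Psi> \<in> hp_maps"
    using \<Psi> subsetD[OF cp_maps_subset_hp_maps \<Upsilon>] by (simp add: dual_cone_def hp_maps_compose)
  have "map_inner f (\<Upsilon> o\<^sub>L \<Psi> o\<^sub>L \<Omega>) \<Phi> \<in> \<real>\<^sub>\<ge>\<^sub>0" if \<Phi>: "\<Phi> \<in> C" for \<Phi>
  proof -
    have "\<Phi> \<in> clinear_maps" using C \<Phi> by (auto simp: mcs_cone_def positive_maps_def)
    \<comment> \<open>Both factors move across as adjoints; the final unfolding only reconciles the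
      two bracketings of the triple composition.\<close>
    then have "map_inner f (\<Upsilon> o\<^sub>L \<Psi> o\<^sub>L \<Omega>) \<Phi> = map_inner f \<Psi> (\<Upsilon>' o\<^sub>L \<Phi> o\<^sub>L \<Omega>')"
      by (simp add: map_inner_compose_right[OF f \<Omega>'(2) hp_maps_clinear[OF hp]]
          map_inner_compose_left[OF \<Upsilon>'(2)]) (simp add: map_inner_def)
    moreover have "\<Upsilon>' o\<^sub>L \<Phi> o\<^sub>L \<Omega>' \<in> C"
      by (rule mcs_cone_compose[OF C \<Phi> adjoint_of_cp_maps[OF \<Upsilon> \<Upsilon>'] adjoint_of_cp_maps[OF \<Omega> \<Omega>']])
    ultimately show ?thesis using \<Psi> by (simp add: dual_cone_def)
  qed
  then show ?thesis
    using hp_maps_compose[OF hp subsetD[OF cp_maps_subset_hp_maps \<Omega>]] by (simp add: dual_cone_def)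
qed

theorem proposition2:
  fixes f :: "'k::finite \<Rightarrow> complex ^ 'k"
    and C :: "('k, 'h::finite) superop set"
  assumes "orthonormal_basis f"
    and "mcs_cone C"
  shows "mcs_cone (dual_cone f C)"
proof -
  have "C \<subseteq> positive_maps" using assms(2) by (simp add: mcs_cone_def)
  then have "dual_cone f C \<noteq> {0}"
    using rank_one_map_in_dual_cone[OF assms(1)] rank_one_map_neq_0 by blast
  then show ?thesis
    unfolding mcs_cone_def
    using dual_cone_subset_positive_maps[OF assms] closed_dual_cone convex_cone_dual_cone
      dual_cone_compose[OF assms] by blast
qed

end
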